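(* Let $X$ be a random vector in $\mathbb{R}^q$ and $Y$ a categorical random variable with values in $\mathbb{Y}=\{L_1,\dots,L_K\}$, $\Pr(Y=L_k)=p_k\in(0,1)$ for each $k$. Let $(x_1,y_1),\dots,(x_n,y_n)$ be an iid sample of $(X,Y)$ and let $\kappa$ be a Mercer kernel on $\mathbb{R}^q$ whose induced distance function $d_\kappa$ takes values in $[0,1)$. Let $G$ be the event that $n_k>2$ for all $k=1,\dots,K$. Then for every $\epsilon>0$, $$\Pr\left[G\ \text{and}\ \mathrm{gCov}_\kappa^n-\mathrm{gCov}_\kappa(X,Y)\ge\epsilon\right]\le\exp\left(\frac{-n\epsilon^2}{12.5}\right)$$ and $$\Pr\left[G\ \text{and}\ \mathrm{gCov}_\kappa(X,Y)-\mathrm{gCov}_\kappa^n\ge\epsilon\right]\le\exp\left(\frac{-n\epsilon^2}{12.5}\right).$$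
   Context: A Mercer kernel on $\mathbb{R}^q$ is a continuous, symmetric, positive (semi)definite function $\kappa:\mathbb{R}^q\times\mathbb{R}^q\to\mathbb{R}$; it induces $d_\kappa(x,x')=\sqrt{\kappa(x,x)+\kappa(x',x')-2\kappa(x,x')}$. Let $F$ be the distribution of $X$ and $F_k$ the conditional distribution of $X$ given $Y=L_k$, so $F=\sum_kp_kF_k$. Let $X,X'\sim F$ and $X_k,X_k'\sim F_k$, all independent. Put $\Delta=\mathbb{E}d_\kappa(X,X')$, $\Delta_k=\mathbb{E}d_\kappa(X_k,X_k')$. The generalized Gini distance covariance is $$\mathrm{gCov}_\kappa(X,Y)=\sum_{k=1}^K p_k\left[2\,\mathbb{E}d_\kappa(X_k,X)-\mathbb{E}d_\kappa(X_k,X_k')-\mathbb{E}d_\kappa(X,X')\right]=\Delta-\sum_{k=1}^Kp_k\Delta_k.$$ Given the sample, let $\mathcal{I}_k=\{i: y_i=L_k\}$, $n_k=|\mathcal{I}_k|$, $\hat p_k=n_k/n$, and $$\hat\Delta_k=\binom{n_k}{2}^{-1}\sum_{i<j\in\mathcal{I}_k}d_\kappa(x_i,x_j),\qquad \hat\Delta=\binom n2^{-1}\sum_{i<j}d_\kappa(x_i,x_j),\qquad \mathrm{gCov}_\kappa^n=\hat\Delta-\sum_{k=1}^K\hat p_k\hat\Delta_k .$$ The estimator is considered only for samples with $n_k>2$ for all $k$. *)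

theory Defs
  imports "HOL-Probability.Probability"
begin

definition mercer_kernel ::
  "(('a::topological_space) \<Rightarrow> 'a \<Rightarrow> real) \<Rightarrow> bool" where
  "mercer_kernel \<kappa> \<longleftrightarrow>
     continuous_on UNIV (\<lambda>(x, x'). \<kappa> x x') \<and>
     (\<forall>x x'. \<kappa> x x' = \<kappa> x' x) \<and>
     (\<forall>(m::nat) x c. 0 \<le> (\<Sum>i<m. \<Sum>j<m. c i * c j * \<kappa> (x i) (x j)))"

definition kernel_dist :: "('a \<Rightarrow> 'a \<Rightarrow> real) \<Rightarrow> 'a \<Rightarrow> 'a \<Rightarrow> real" where
  "kernel_dist \<kappa> x x' = sqrt (\<kappa> x x + \<kappa> x' x' - 2 * \<kappa> x x')"

text \<open>The expectation of \<open>d U V\<close> for independent \<open>U\<close>, \<open>V\<close> with laws \<open>F\<close> and \<open>G\<close>.\<close>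

definition expected_dist :: "('a \<Rightarrow> 'a \<Rightarrow> real) \<Rightarrow> 'a measure \<Rightarrow> 'a measure \<Rightarrow> real" where
  "expected_dist d F G = (\<integral>z. d (fst z) (snd z) \<partial>(F \<Otimes>\<^sub>M G))"

text \<open>The conditional law of \<open>X\<close> given \<open>Y = l\<close>; it is meaningful when \<open>Y = l\<close> has positive
  probability.\<close>

definition cond_distr ::
  "'w measure \<Rightarrow> ('w \<Rightarrow> 'a::topological_space) \<Rightarrow> ('w \<Rightarrow> 'l) \<Rightarrow> 'l \<Rightarrow> 'a measure" where
  "cond_distr M X Y l = distr (uniform_measure M {\<omega> \<in> space M. Y \<omega> = l}) borel X"

definition gCov ::
  "('a::topological_space \<Rightarrow> 'a \<Rightarrow> real) \<Rightarrow> 'w measure \<Rightarrow> ('w \<Rightarrow> 'a) \<Rightarrow> ('w \<Rightarrow> 'l) \<Rightarrow>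
     (nat \<Rightarrow> 'l) \<Rightarrow> nat \<Rightarrow> real" where
  "gCov \<kappa> M X Y L K =
     (let F = distr M borel X;
          d = kernel_dist \<kappa>
      in \<Sum>k=1..K. let Fk = cond_distr M X Y (L k) in
           measure M {\<omega> \<in> space M. Y \<omega> = L k} *
             (2 * expected_dist d Fk F - expected_dist d Fk Fk - expected_dist d F F))"

definition class_indices :: "nat \<Rightarrow> (nat \<Rightarrow> 'l) \<Rightarrow> 'l \<Rightarrow> nat set" where
  "class_indices n y l = {i \<in> {1..n}. y i = l}"

definition gini_mean :: "('a \<Rightarrow> 'a \<Rightarrow> real) \<Rightarrow> nat set \<Rightarrow> (nat \<Rightarrow> 'a) \<Rightarrow> real" where
  "gini_mean d I x =
     inverse (real (card I choose 2)) * (\<Sum>(i, j) \<in> {(i, j) \<in> I \<times> I. i < j}. d (x i) (x j))"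

definition gCov_sample ::
  "('a \<Rightarrow> 'a \<Rightarrow> real) \<Rightarrow> (nat \<Rightarrow> 'l) \<Rightarrow> nat \<Rightarrow> nat \<Rightarrow> (nat \<Rightarrow> 'a) \<Rightarrow> (nat \<Rightarrow> 'l) \<Rightarrow> real" where
  "gCov_sample \<kappa> L K n x y =
     gini_mean (kernel_dist \<kappa>) {1..n} x -
     (\<Sum>k=1..K. real (card (class_indices n y (L k))) / real n *
        gini_mean (kernel_dist \<kappa>) (class_indices n y (L k)) x)"

end

theory Submission
  imports Defs
begin

text \<open>
  Write the estimator as \<open>1/n\<close> times the pooled sum \<open>n \<Delta>^\<close> minus the class sums \<open>n_k \<Delta>^_k\<close>. Replacing one
  observation changes the pooled sum by at most \<open>2\<close>. Adding a point to a class changes its sum by a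
  number in \<open>[-1, 2]\<close>, so moving a point from one class to another changes the total of the class sums
  by at most \<open>3\<close>, and moving it within a class by at most \<open>2\<close>. Hence the estimator has differences
  bounded by \<open>5/n\<close>, and McDiarmid's inequality gives the rate \<open>2 \<epsilon>\<^sup>2 / (n (5/n)\<^sup>2) = n \<epsilon>\<^sup>2 / 12.5\<close>.

  On classes with fewer than two points the estimator has no meaningful value. Setting the class sum
  to \<open>\<Delta>_k\<close> for a single point and to \<open>0\<close> for none gives a statistic which agrees with the estimator
  on the event in question, still has bounded differences, and has expectation exactly the
  population covariance, because the class sum then has conditional mean \<open>n_k \<Delta>_k\<close> given the labels.
\<close>

section \<open>McDiarmid's inequality\<close>

text \<open>The coordinates of \<open>w\<close> are replaced by those of \<open>w'\<close> one at a
  time; \<open>J\<close> holds the coordinates where the two may still differ. This makes a function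
  with bounded differences bounded, hence integrable once it is measurable.\<close>

lemma bounded_differences_PiE:
  fixes f :: "('i \<Rightarrow> 'a) \<Rightarrow> real" and S :: "'i \<Rightarrow> 'a set"
  assumes "finite I"
    and diff: "\<And>w i z. w \<in> Pi\<^sub>E I S \<Longrightarrow> i \<in> I \<Longrightarrow> z \<in> S i \<Longrightarrow> \<bar>f w - f (w(i := z))\<bar> \<le> c i"
    and "w \<in> Pi\<^sub>E I S" "w' \<in> Pi\<^sub>E I S"
  shows "\<bar>f w - f w'\<bar> \<le> (\<Sum>i\<in>I. c i)"
proof -
  have "\<bar>f w - f w'\<bar> \<le> (\<Sum>i\<in>J. c i)"
    if "finite J" "J \<subseteq> I" "w \<in> Pi\<^sub>E I S" "\<forall>i\<in>I - J. w i = w' i" for J w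
    using that
  proof (induction J arbitrary: w rule: finite_induct)
    case empty
    then have "w = w'"
      using \<open>w' \<in> Pi\<^sub>E I S\<close> by (intro PiE_ext) auto
    then show ?case by simp
  next
    case (insert j J)
    let ?w = "w(j := w' j)"
    have "w' j \<in> S j"
      using insert.prems \<open>w' \<in> Pi\<^sub>E I S\<close> by auto
    then have "?w \<in> Pi\<^sub>E I S" "\<bar>f w - f ?w\<bar> \<le> c j"
      using insert.prems diff by (auto simp: PiE_iff extensional_def)
    moreover from this(1) have "\<bar>f ?w - f w'\<bar> \<le> (\<Sum>i\<in>J. c i)"
      using insert.prems by (intro insert.IH) auto
    ultimately show ?case
      using insert.hyps by simp
  qed
  from this[of I w] show ?thesis
    using assms by auto
qed

context product_prob_space
begin

text \<open>Induction on the coordinates replaces the usual martingale. Averaging over the new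
  coordinate \<open>i\<close> gives \<open>g\<close>, which has the same mean as \<open>f\<close>
  and inherits the bounds \<open>c j\<close> for the old coordinates. The fluctuation of
  \<open>f\<close> around \<open>g\<close> depends on one variable at a time and costs one Hoeffding
  factor.\<close>

lemma mgf_le_of_bounded_differences:
  fixes f :: "('i \<Rightarrow> 'a) \<Rightarrow> real"
  assumes "finite J" "f \<in> borel_measurable (Pi\<^sub>M J M)" "l > 0"
    and "\<And>w i z. w \<in> space (Pi\<^sub>M J M) \<Longrightarrow> i \<in> J \<Longrightarrow> z \<in> space (M i) \<Longrightarrow>
           \<bar>f w - f (w(i := z))\<bar> \<le> c i"
  shows "(\<integral>\<^sup>+w. exp (l * (f w - integral\<^sup>L (Pi\<^sub>M J M) f)) \<partial>Pi\<^sub>M J M)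
           \<le> ennreal (exp (l\<^sup>2 * (\<Sum>i\<in>J. (c i)\<^sup>2) / 8))"
  using assms
proof (induction J arbitrary: f rule: finite_induct)
  case empty
  have "integral\<^sup>L (Pi\<^sub>M {} M) f = f (\<lambda>_. undefined)"
    by (simp add: PiM_empty lebesgue_integral_count_space_finite)
  then show ?case
    by (simp add: PiM_empty nn_integral_count_space_finite)
next
  case (insert i J)
  note [measurable] = insert.prems(1)
  interpret PJ: prob_space "Pi\<^sub>M J M" by (rule prob_space_PiM) (rule M.prob_space_axioms)
  interpret Q: prob_space "Pi\<^sub>M (insert i J) M" by (rule prob_space_PiM) (rule M.prob_space_axioms)
  let ?E = "integral\<^sup>L (Pi\<^sub>M (insert i J) M) f"
  define g where "g w = (\<integral>z. f (w(i := z)) \<partial>M i)" for w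
  have upd: "w(i := z) \<in> space (Pi\<^sub>M (insert i J) M)"
    if "w \<in> space (Pi\<^sub>M J M)" "z \<in> space (M i)" for w z
    using that by (auto simp: space_PiM PiE_iff extensional_def)
  obtain w0 where w0: "w0 \<in> space (Pi\<^sub>M (insert i J) M)"
    using Q.not_empty by blast
  have "\<bar>f w - f w0\<bar> \<le> (\<Sum>i\<in>insert i J. c i)" if "w \<in> space (Pi\<^sub>M (insert i J) M)" for w
    by (rule bounded_differences_PiE[where S = "\<lambda>i. space (M i)"])
       (use insert that w0 in \<open>auto simp: space_PiM\<close>)
  then have fB: "\<bar>f w\<bar> \<le> \<bar>f w0\<bar> + (\<Sum>i\<in>insert i J. c i)"
    if "w \<in> space (Pi\<^sub>M (insert i J) M)" for w
    using that by fastforce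
  have intf: "integrable (Pi\<^sub>M (insert i J) M) f"
    by (rule Q.integrable_const_bound[where B = "\<bar>f w0\<bar> + (\<Sum>i\<in>insert i J. c i)"])
       (use fB in auto)
  have sec_meas [measurable]: "(\<lambda>z. f (w(i := z))) \<in> borel_measurable (M i)"
    if "w \<in> space (Pi\<^sub>M J M)" for w
    using that insert.hyps by measurable
  have sec_int: "integrable (M i) (\<lambda>z. f (w(i := z)))" if "w \<in> space (Pi\<^sub>M J M)" for w
    by (rule M.integrable_const_bound[where B = "\<bar>f w0\<bar> + (\<Sum>i\<in>insert i J. c i)"])
       (use fB upd that sec_meas in auto)
  have g_meas [measurable]: "g \<in> borel_measurable (Pi\<^sub>M J M)"
    unfolding g_def by measurable
  have Eg: "integral\<^sup>L (Pi\<^sub>M J M) g = ?E"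
    unfolding g_def using insert.hyps intf by (subst product_integral_insert) auto
  have g_diff: "\<bar>g w - g (w(j := z))\<bar> \<le> c j"
    if w: "w \<in> space (Pi\<^sub>M J M)" and j: "j \<in> J" and z: "z \<in> space (M j)" for w j z
  proof -
    have w': "w(j := z) \<in> space (Pi\<^sub>M J M)"
      using that by (auto simp: space_PiM PiE_iff extensional_def)
    have ij: "i \<noteq> j" using j insert.hyps by auto
    have "\<bar>g w - g (w(j := z))\<bar> = \<bar>\<integral>t. f (w(i := t)) - f (w(j := z, i := t)) \<partial>M i\<bar>"
      unfolding g_def using sec_int[OF w] sec_int[OF w'] by simp
    also have "\<dots> \<le> (\<integral>t. \<bar>f (w(i := t)) - f (w(j := z, i := t))\<bar> \<partial>M i)"
      by (rule integral_abs_bound)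
    also have "\<dots> \<le> (\<integral>t. c j \<partial>M i)"
    proof (rule integral_mono)
      show "integrable (M i) (\<lambda>t. \<bar>f (w(i := t)) - f (w(j := z, i := t))\<bar>)"
        using sec_int[OF w] sec_int[OF w'] by simp
      show "\<bar>f (w(i := t)) - f (w(j := z, i := t))\<bar> \<le> c j" if "t \<in> space (M i)" for t
        using insert.prems(3)[OF upd[OF w that] insertI2[OF j] z] unfolding fun_upd_twist[OF ij] .
    qed simp
    finally show ?thesis by (simp add: M.prob_space)
  qed
  have hoeff: "(\<integral>\<^sup>+z. exp (l * (f (w(i := z)) - g w)) \<partial>M i) \<le> ennreal (exp (l\<^sup>2 * (c i)\<^sup>2 / 8))"
    if w: "w \<in> space (Pi\<^sub>M J M)" for w
  proof -
    let ?h = "\<lambda>z. f (w(i := z))"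
    \<comment> \<open>The bound compares any two values of the fibre function, so its range fits in
      an interval of length \<open>c i\<close> above its infimum. An interval centred at one value
      would have length \<open>2 * c i\<close> and lose a factor 4 in the exponent.\<close>
    define a where "a = (INF z\<in>space (M i). ?h z)"
    have osc: "?h z - c i \<le> ?h z'" if "z \<in> space (M i)" "z' \<in> space (M i)" for z z'
      using insert.prems(3)[OF upd[OF w that(1)] insertI1 that(2)] unfolding fun_upd_upd by linarith
    obtain z0 where z0: "z0 \<in> space (M i)"
      using M.not_empty by blast
    have "bdd_below (?h ` space (M i))"
      using osc[OF z0] by (intro bdd_belowI2) auto
    then have "a \<le> ?h z" if "z \<in> space (M i)" for z
      unfolding a_def using that by (rule cINF_lower)
    moreover have "?h z - c i \<le> a" if "z \<in> space (M i)" for z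
      unfolding a_def using osc[OF that] M.not_empty by (intro cINF_greatest) auto
    ultimately interpret interval_bounded_random_variable "M i" ?h a "a + c i"
      by unfold_locales (use w in \<open>auto simp: algebra_simps\<close>)
    show ?thesis
      using Hoeffdings_lemma_nn_integral[OF \<open>l > 0\<close>] by (simp add: g_def)
  qed
  have "(\<integral>\<^sup>+w. exp (l * (f w - ?E)) \<partial>Pi\<^sub>M (insert i J) M)
      = (\<integral>\<^sup>+w. \<integral>\<^sup>+z. exp (l * (f (w(i := z)) - ?E)) \<partial>M i \<partial>Pi\<^sub>M J M)"
    using insert.hyps by (subst product_nn_integral_insert) auto
  \<comment> \<open>\<open>g w\<close> does not involve the new coordinate, so its exponential
    leaves the inner integral.\<close>
  also have "\<dots> = (\<integral>\<^sup>+w. exp (l * (g w - ?E)) * (\<integral>\<^sup>+z. exp (l * (f (w(i := z)) - g w)) \<partial>M i) \<partial>Pi\<^sub>M J M)"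
  proof (rule nn_integral_cong)
    fix w assume w: "w \<in> space (Pi\<^sub>M J M)"
    have "exp (l * (f (w(i := z)) - ?E)) = exp (l * (g w - ?E)) * exp (l * (f (w(i := z)) - g w))"
      for z by (simp add: algebra_simps flip: exp_add)
    then show "(\<integral>\<^sup>+z. exp (l * (f (w(i := z)) - ?E)) \<partial>M i)
        = exp (l * (g w - ?E)) * (\<integral>\<^sup>+z. exp (l * (f (w(i := z)) - g w)) \<partial>M i)"
      using w by (subst nn_integral_cmult[symmetric]) (auto simp: ennreal_mult)
  qed
  also have "\<dots> \<le> (\<integral>\<^sup>+w. exp (l * (g w - ?E)) * ennreal (exp (l\<^sup>2 * (c i)\<^sup>2 / 8)) \<partial>Pi\<^sub>M J M)"
    by (intro nn_integral_mono mult_left_mono hoeff) auto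
  also have "\<dots> = (\<integral>\<^sup>+w. exp (l * (g w - ?E)) \<partial>Pi\<^sub>M J M) * ennreal (exp (l\<^sup>2 * (c i)\<^sup>2 / 8))"
    by (rule nn_integral_multc) measurable
  also have "\<dots> \<le> ennreal (exp (l\<^sup>2 * (\<Sum>j\<in>J. (c j)\<^sup>2) / 8)) * ennreal (exp (l\<^sup>2 * (c i)\<^sup>2 / 8))"
    using insert.IH[OF g_meas \<open>l > 0\<close> g_diff] by (intro mult_right_mono) (auto simp: Eg)
  also have "\<dots> = ennreal (exp (l\<^sup>2 * (\<Sum>j\<in>insert i J. (c j)\<^sup>2) / 8))"
    using insert.hyps by (simp add: algebra_simps add_divide_distrib flip: exp_add ennreal_mult)
  finally show ?case .
qed

text \<open>Chernoff's bound applied to the moment generating function estimate.\<close>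

lemma McDiarmid_ineq_ge:
  fixes f :: "('i \<Rightarrow> 'a) \<Rightarrow> real"
  assumes "finite J" and [measurable]: "f \<in> borel_measurable (Pi\<^sub>M J M)" and "\<epsilon> > 0"
    and pos: "(\<Sum>i\<in>J. (c i)\<^sup>2) > 0"
    and "\<And>w i z. w \<in> space (Pi\<^sub>M J M) \<Longrightarrow> i \<in> J \<Longrightarrow> z \<in> space (M i) \<Longrightarrow>
           \<bar>f w - f (w(i := z))\<bar> \<le> c i"
  shows "measure (Pi\<^sub>M J M) {w \<in> space (Pi\<^sub>M J M). f w - integral\<^sup>L (Pi\<^sub>M J M) f \<ge> \<epsilon>}
           \<le> exp (- 2 * \<epsilon>\<^sup>2 / (\<Sum>i\<in>J. (c i)\<^sup>2))"
proof -
  interpret PJ: prob_space "Pi\<^sub>M J M" by (rule prob_space_PiM) (rule M.prob_space_axioms)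
  define d where "d = (\<Sum>i\<in>J. (c i)\<^sup>2)"
  \<comment> \<open>This is the minimiser of l^2 d / 8 - l \<epsilon>, with minimum -2 \<epsilon>^2
    / d.\<close>
  define l where "l = 4 * \<epsilon> / d"
  let ?E = "integral\<^sup>L (Pi\<^sub>M J M) f"
  have d: "d > 0" and l: "l > 0"
    using pos \<open>\<epsilon> > 0\<close> by (auto simp: d_def l_def)
  have "ennreal (PJ.prob {w \<in> space (Pi\<^sub>M J M). f w - ?E \<ge> \<epsilon>})
      = emeasure (Pi\<^sub>M J M) {w \<in> space (Pi\<^sub>M J M). f w - ?E \<ge> \<epsilon>}"
    by (simp add: PJ.emeasure_eq_measure)
  also have "\<dots> \<le> ennreal (exp (- l * \<epsilon>)) *
      (\<integral>\<^sup>+w\<in>space (Pi\<^sub>M J M). exp (l * (f w - ?E)) \<partial>Pi\<^sub>M J M)"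
    by (intro Chernoff_ineq_nn_integral_ge l) auto
  also have "(\<integral>\<^sup>+w\<in>space (Pi\<^sub>M J M). exp (l * (f w - ?E)) \<partial>Pi\<^sub>M J M)
      = (\<integral>\<^sup>+w. exp (l * (f w - ?E)) \<partial>Pi\<^sub>M J M)"
    by (intro nn_integral_cong) simp
  also have "ennreal (exp (- l * \<epsilon>)) * \<dots> \<le> ennreal (exp (- l * \<epsilon>)) * ennreal (exp (l\<^sup>2 * d / 8))"
    unfolding d_def using assms l by (intro mult_left_mono mgf_le_of_bounded_differences) auto
  also have "\<dots> = ennreal (exp (l\<^sup>2 * d / 8 - l * \<epsilon>))"
    by (simp flip: ennreal_mult exp_add)
  also have "l\<^sup>2 * d / 8 - l * \<epsilon> = - 2 * \<epsilon>\<^sup>2 / d"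
    using d by (simp add: l_def field_simps power2_eq_square)
  finally show ?thesis
    by (simp add: d_def)
qed

end

section \<open>Bounded differences of the Gini sums\<close>

text \<open>
  For \<open>card J \<ge> 2\<close> this is \<open>card J\<close> times the Gini mean difference, whatever \<open>c\<close> is; it is \<open>c\<close> on
  singletons and \<open>0\<close> on the empty set. With \<open>c\<close> the population mean difference, these two values
  are the ones that keep the random version unbiased and its differences bounded.
\<close>

definition gini_sum :: "real \<Rightarrow> ('i \<Rightarrow> 'i \<Rightarrow> real) \<Rightarrow> 'i set \<Rightarrow> real" where
  "gini_sum c e J = c * real (card J) + (\<Sum>i\<in>J. \<Sum>j\<in>J - {i}. e i j - c) / (real (card J) - 1)"

lemma gini_sum_empty [simp]: "gini_sum c e {} = 0"
  by (simp add: gini_sum_def)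

lemma gini_sum_singleton [simp]: "gini_sum c e {i} = c"
  by (simp add: gini_sum_def)

lemma gini_sum_cong:
  assumes "J = J'" "\<And>i j. i \<in> J' \<Longrightarrow> j \<in> J' \<Longrightarrow> e i j = e' i j"
  shows "gini_sum c e J = gini_sum c e' J'"
  unfolding gini_sum_def using assms by (auto intro!: sum.cong arg_cong2[where f = "(/)"])

lemma real_card_Diff_singleton:
  assumes "finite J" "i \<in> J"
  shows "real (card (J - {i})) = real (card J) - 1"
  using card.remove[OF assms] by simp

text \<open>There are \<open>card J * (card J - 1)\<close> ordered pairs, so the centring removes
  exactly the leading term \<open>c * card J\<close>. A singleton is excluded because it has no
  pairs and keeps the value \<open>c\<close>.\<close>

lemma gini_sum_eq:
  assumes "finite J" "card J \<noteq> 1"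
  shows "gini_sum c e J = (\<Sum>i\<in>J. \<Sum>j\<in>J - {i}. e i j) / (real (card J) - 1)"
proof -
  have "(\<Sum>i\<in>J. \<Sum>j\<in>J - {i}. e i j - c) = (\<Sum>i\<in>J. (\<Sum>j\<in>J - {i}. e i j) - (real (card J) - 1) * c)"
    using assms by (intro sum.cong refl) (simp add: sum_subtractf real_card_Diff_singleton del: card_Diff_insert card_Diff_singleton)
  also have "\<dots> = (\<Sum>i\<in>J. \<Sum>j\<in>J - {i}. e i j) - real (card J) * (real (card J) - 1) * c"
    by (simp add: sum_subtractf)
  finally show ?thesis
    using assms by (simp add: gini_sum_def field_simps)
qed

lemma sum_offdiag_insert:
  fixes e :: "'i \<Rightarrow> 'i \<Rightarrow> real"
  assumes "finite J" "i \<notin> J" "\<And>a b. e a b = e b a"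
  shows "(\<Sum>a\<in>insert i J. \<Sum>b\<in>insert i J - {a}. e a b)
       = (\<Sum>a\<in>J. \<Sum>b\<in>J - {a}. e a b) + 2 * (\<Sum>b\<in>J. e i b)"
proof -
  have "(\<Sum>b\<in>insert i J - {a}. e a b) = e i a + (\<Sum>b\<in>J - {a}. e a b)" if "a \<in> J" for a
  proof -
    have "insert i J - {a} = insert i (J - {a})" using that assms by auto
    then show ?thesis using assms that by simp
  qed
  then have "(\<Sum>a\<in>J. \<Sum>b\<in>insert i J - {a}. e a b) = (\<Sum>a\<in>J. e i a + (\<Sum>b\<in>J - {a}. e a b))"
    by (intro sum.cong) auto
  moreover have "insert i J - {i} = J" using assms by auto
  ultimately show ?thesis
    using assms by (simp add: sum.distrib)
qed

text \<open>The enlarged set has \<open>card J + 1\<close> points, so its denominator is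
  \<open>card J\<close>.\<close>

lemma gini_sum_insert:
  assumes "finite J" "i \<notin> J" "J \<noteq> {}" "\<And>a b. e a b = e b a"
  shows "gini_sum c e (insert i J)
       = ((\<Sum>a\<in>J. \<Sum>b\<in>J - {a}. e a b) + 2 * (\<Sum>b\<in>J. e i b)) / real (card J)"
  using gini_sum_eq[of "insert i J" c e] sum_offdiag_insert[OF assms(1,2,4)] assms(1-3)
  by (simp del: sum.insert)

lemma sum_offdiag_bounds:
  fixes e :: "'i \<Rightarrow> 'i \<Rightarrow> real"
  assumes "finite J" "\<And>a b. e a b \<in> {0..1}"
  shows "(\<Sum>a\<in>J. \<Sum>b\<in>J - {a}. e a b) \<in> {0..real (card J) * (real (card J) - 1)}"
proof -
  have "(\<Sum>b\<in>J - {a}. e a b) \<le> real (card J) - 1" if "a \<in> J" for a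
  proof -
    have "(\<Sum>b\<in>J - {a}. e a b) \<le> (\<Sum>b\<in>J - {a}. 1)"
      using assms by (intro sum_mono) auto
    also have "\<dots> = real (card J) - 1"
      using assms that by (simp add: real_card_Diff_singleton del: card_Diff_insert card_Diff_singleton)
    finally show ?thesis .
  qed
  then have "(\<Sum>a\<in>J. \<Sum>b\<in>J - {a}. e a b) \<le> (\<Sum>a\<in>J. real (card J) - 1)"
    by (intro sum_mono)
  then show ?thesis
    using assms by (auto intro!: sum_nonneg)
qed

text \<open>With at least two old points, the change is twice the mean distance to the new point
  minus the mean distance over old pairs, and both means lie in [0, 1]. From the empty set the
  change is \<open>c\<close>, and from a singleton it is twice a distance minus \<open>c\<close>, so
  the default values respect the same range.\<close>

lemma gini_sum_insert_diff:
  assumes "finite J" "i \<notin> J" "\<And>a b. e a b = e b a" "\<And>a b. e a b \<in> {0..1}" "c \<in> {0..1}"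
  shows "gini_sum c e (insert i J) - gini_sum c e J \<in> {-1..2}"
proof -
  define m S r where "m = real (card J)" and "S = (\<Sum>a\<in>J. \<Sum>b\<in>J - {a}. e a b)"
    and "r = (\<Sum>b\<in>J. e i b)"
  have r: "0 \<le> r" "r \<le> m"
    unfolding r_def m_def using assms sum_mono[of J "e i" "\<lambda>_. 1"] by (auto intro!: sum_nonneg)
  have S: "0 \<le> S" "S \<le> m * (m - 1)"
    using sum_offdiag_bounds[of J e] assms unfolding S_def m_def by auto
  consider "J = {}" | j where "J = {j}" | "card J \<ge> 2"
    using assms(1) by (metis One_nat_def Suc_1 card_0_eq card_1_singletonE le_less_linear less_2_cases)
  then show ?thesis
  proof cases
    case 1
    then show ?thesis using assms by simp
  next
    case (2 j)
    have "gini_sum c e (insert i J) = 2 * r"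
      using 2 gini_sum_insert[of J i e, OF assms(1,2) _ assms(3)] by (simp add: r_def)
    then show ?thesis
      using 2 r assms(5) by (auto simp: m_def)
  next
    case 3
    then have m: "m \<ge> 2" by (simp add: m_def)
    have "gini_sum c e (insert i J) = (S + 2 * r) / m"
      using 3 gini_sum_insert[of J i e, OF assms(1,2) _ assms(3), of c] by (force simp: r_def m_def S_def)
    moreover have "gini_sum c e J = S / (m - 1)"
      using assms 3 by (subst gini_sum_eq) (auto simp: m_def S_def)
    ultimately have "gini_sum c e (insert i J) - gini_sum c e J = 2 * (r / m) - S / (m * (m - 1))"
      using m by (simp add: field_simps)
    moreover have "r / m \<in> {0..1}" "S / (m * (m - 1)) \<in> {0..1}"
      using r S m by (auto simp: divide_le_eq)
    ultimately show ?thesis by auto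
  qed
qed

text \<open>Pairs inside \<open>J\<close> cancel. What remains is twice the difference of two mean
  distances from the moved point to \<open>J\<close>.\<close>

lemma gini_sum_move_diff:
  assumes "finite J" "i \<notin> J" "\<And>a b. e a b = e b a" "\<And>a b. e a b \<in> {0..1}"
    and "\<And>a b. e' a b = e' b a" "\<And>a b. e' a b \<in> {0..1}"
    and "\<And>a b. a \<in> J \<Longrightarrow> b \<in> J \<Longrightarrow> e a b = e' a b"
  shows "\<bar>gini_sum c e (insert i J) - gini_sum c e' (insert i J)\<bar> \<le> 2"
proof (cases "J = {}")
  case False
  define m r r' where "m = real (card J)" and "r = (\<Sum>b\<in>J. e i b)" and "r' = (\<Sum>b\<in>J. e' i b)"
  have m: "m > 0" using False assms by (auto simp: m_def card_gt_0_iff)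
  have r: "0 \<le> r" "r \<le> m" "0 \<le> r'" "r' \<le> m"
    unfolding r_def r'_def m_def
    using assms sum_mono[of J "e i" "\<lambda>_. 1"] sum_mono[of J "e' i" "\<lambda>_. 1"]
    by (auto intro!: sum_nonneg)
  have "(\<Sum>a\<in>J. \<Sum>b\<in>J - {a}. e a b) = (\<Sum>a\<in>J. \<Sum>b\<in>J - {a}. e' a b)"
    using assms by (intro sum.cong) auto
  then have "gini_sum c e (insert i J) - gini_sum c e' (insert i J) = (2 * r - 2 * r') / m"
    using gini_sum_insert[OF assms(1,2) False, of e] gini_sum_insert[OF assms(1,2) False, of e']
      assms(3,5) by (simp add: r_def r'_def m_def flip: diff_divide_distrib)
  then show ?thesis
    using r m by (simp add: abs_le_iff divide_le_eq le_divide_eq)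
qed simp

text \<open>Both samples are compared with the one from which point \<open>i\<close> is deleted;
  each arises from it by one insertion. If the labels agree, the point moves within one class and
  the change is at most 2. Otherwise it is the difference of two insertion costs in [-1, 2], hence
  at most 3.\<close>

lemma sum_gini_sum_upd:
  fixes w :: "'i \<Rightarrow> 'a \<times> 'l" and I :: "'i set" and d :: "'a \<Rightarrow> 'a \<Rightarrow> real"
  defines "idx \<equiv> \<lambda>w l. {j \<in> I. snd (w j) = l}"
    and "e \<equiv> \<lambda>w i j. d (fst (w i)) (fst (w j))"
  assumes "finite I" "finite \<Lambda>" and i: "i \<in> I" and labels: "snd (w i) \<in> \<Lambda>" "snd z \<in> \<Lambda>"
    and d: "\<And>a b. d a b = d b a" "\<And>a b. d a b \<in> {0..1}" and c: "\<And>l. l \<in> \<Lambda> \<Longrightarrow> c l \<in> {0..1}"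
  shows "\<bar>(\<Sum>l\<in>\<Lambda>. gini_sum (c l) (e w) (idx w l)) -
          (\<Sum>l\<in>\<Lambda>. gini_sum (c l) (e (w(i := z))) (idx (w(i := z)) l))\<bar> \<le> 3"
proof -
  define J where "J l = {j \<in> I - {i}. snd (w j) = l}" for l
  define B where "B l = gini_sum (c l) (e w) (J l)" for l
  have J: "finite (J l)" "i \<notin> J l" for l
    using \<open>finite I\<close> by (auto simp: J_def)
  have e: "e v a b = e v b a" "e v a b \<in> {0..1}" for v a b
    using d by (auto simp: e_def)
  have idx: "idx v l = (if l = snd (v i) then insert i (J l) else J l)"
    and B: "gini_sum (c l) (e v) (J l) = B l"
    if "v = w \<or> v = w(i := z)" for v l
  proof -
    show "idx v l = (if l = snd (v i) then insert i (J l) else J l)"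
      using that i by (auto simp: idx_def J_def)
    show "gini_sum (c l) (e v) (J l) = B l"
      unfolding B_def using that by (intro gini_sum_cong) (auto simp: e_def J_def)
  qed
  have split: "(\<Sum>l\<in>\<Lambda>. gini_sum (c l) (e v) (idx v l))
      = (\<Sum>l\<in>\<Lambda>. B l) + (gini_sum (c k) (e v) (insert i (J k)) - B k)"
    if v: "v = w \<or> v = w(i := z)" and k: "k = snd (v i)" for v k
  proof -
    have "k \<in> \<Lambda>" using v k labels by auto
    have "(\<Sum>l\<in>\<Lambda>. gini_sum (c l) (e v) (idx v l))
        = (\<Sum>l\<in>\<Lambda>. B l + (if l = k then gini_sum (c k) (e v) (insert i (J k)) - B k else 0))"
      using idx[OF v] B[OF v] k by (intro sum.cong) auto
    then show ?thesis
      using \<open>finite \<Lambda>\<close> \<open>k \<in> \<Lambda>\<close> by (simp add: sum.distrib)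
  qed
  have ins: "gini_sum (c l) (e v) (insert i (J l)) - B l \<in> {-1..2}"
    if v: "v = w \<or> v = w(i := z)" and "l \<in> \<Lambda>" for v l
    using gini_sum_insert_diff[of "J l" i "e v" "c l", OF J e c[OF that(2)]] B[OF v] by simp
  show ?thesis
  proof (cases "snd (w i) = snd z")
    case True
    have "\<bar>gini_sum (c (snd z)) (e w) (insert i (J (snd z))) -
           gini_sum (c (snd z)) (e (w(i := z))) (insert i (J (snd z)))\<bar> \<le> 2"
      by (intro gini_sum_move_diff J e) (auto simp: e_def J_def)
    then show ?thesis
      using True split[where v = w and k = "snd z"] split[where v = "w(i := z)" and k = "snd z"] by simp
  next
    case False
    then show ?thesis
      using split[where v = w and k = "snd (w i)"] split[where v = "w(i := z)" and k = "snd z"]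
        ins[where v = w and l = "snd (w i)"] ins[where v = "w(i := z)" and l = "snd z"] labels
      by (simp add: abs_le_iff)
  qed
qed

section \<open>Expectation of the Gini sums\<close>

text \<open>
  Each denominator avoids the indices \<open>i\<close> and \<open>j\<close> of its numerator, so that under a product measure
  the two are independent.
\<close>

lemma gini_sum_filter_eq:
  assumes "finite I"
  shows "gini_sum c h {i \<in> I. P i} = c * (\<Sum>i\<in>I. of_bool (P i)) +
    (\<Sum>i\<in>I. \<Sum>j\<in>I - {i}. (if P i \<and> P j then h i j - c else 0) /
       (1 + (\<Sum>m\<in>I - {i, j}. of_bool (P m))))"
proof -
  let ?J = "{i \<in> I. P i}"
  have card: "real (card ?J) = (\<Sum>i\<in>I. of_bool (P i))"
    using assms by (simp add: sum_of_bool_eq Int_def)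
  \<comment> \<open>Removing \<open>i\<close> and \<open>j\<close> leaves \<open>card ?J - 2\<close>
    members of the class, so the added 1 restores the right denominator and also keeps it positive
    for every sample.\<close>
  have others: "1 + (\<Sum>m\<in>I - {i, j}. of_bool (P m)) = real (card ?J) - 1"
    if "i \<in> ?J" "j \<in> ?J - {i}" for i j
  proof -
    have "(\<Sum>m\<in>I. of_bool (P m)) = (of_bool (P i) :: real) + (\<Sum>m\<in>I - {i}. of_bool (P m))"
      using that assms by (intro sum.remove) auto
    also have "(\<Sum>m\<in>I - {i}. of_bool (P m)) = of_bool (P j) + (\<Sum>m\<in>I - {i} - {j}. of_bool (P m))"
      using that assms by (intro sum.remove) auto
    finally show ?thesis
      using that unfolding card by (simp add: Diff_insert2[of I i "{j}"] del: sum_of_bool_eq)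
  qed
  have "(\<Sum>i\<in>?J. \<Sum>j\<in>?J - {i}. h i j - c) / (real (card ?J) - 1)
      = (\<Sum>i\<in>?J. \<Sum>j\<in>?J - {i}. (h i j - c) / (1 + (\<Sum>m\<in>I - {i, j}. of_bool (P m))))"
    unfolding sum_divide_distrib
    by (intro sum.cong refl arg_cong2[where f = "(/)"] others[symmetric])
  \<comment> \<open>Pairs not both in the class contribute 0, which frees the index sets from the
    random class.\<close>
  also have "\<dots> = (\<Sum>i\<in>I. \<Sum>j\<in>I - {i}. (if P i \<and> P j then h i j - c else 0) /
       (1 + (\<Sum>m\<in>I - {i, j}. of_bool (P m))))"
  proof (rule sum.mono_neutral_cong_left[OF assms])
    show "(\<Sum>j\<in>?J - {i}. (h i j - c) / (1 + (\<Sum>m\<in>I - {i, j}. of_bool (P m))))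
        = (\<Sum>j\<in>I - {i}. (if P i \<and> P j then h i j - c else 0) /
       (1 + (\<Sum>m\<in>I - {i, j}. of_bool (P m))))" if "i \<in> ?J" for i
      using assms that by (intro sum.mono_neutral_cong_left) auto
  qed auto
  finally show ?thesis
    unfolding gini_sum_def card by simp
qed

text \<open>The assumption \<open>zero\<close> says that \<open>h - c\<close> averages to 0 over
  independent pairs inside the class. Every centred off-diagonal term then has mean 0, and only
  \<open>c\<close> times the expected class size is left.\<close>

lemma (in prob_space) expectation_gini_sum:
  fixes h :: "'a \<Rightarrow> 'a \<Rightarrow> real" and I :: "'i set"
  assumes "finite I" and [measurable]: "Measurable.pred M Q" "case_prod h \<in> borel_measurable (M \<Otimes>\<^sub>M M)"
    and h: "\<And>a b. h a b \<in> {0..1}" and c: "c \<in> {0..1}"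
    and zero: "(\<integral>b. \<integral>a. (if Q a \<and> Q b then h a b - c else 0) \<partial>M \<partial>M) = 0"
  defines "W \<equiv> \<lambda>w. gini_sum c (\<lambda>i j. h (w i) (w j)) {i \<in> I. Q (w i)}"
  shows "integrable (Pi\<^sub>M I (\<lambda>_. M)) W"
    and "integral\<^sup>L (Pi\<^sub>M I (\<lambda>_. M)) W = c * real (card I) * prob {a \<in> space M. Q a}"
proof -
  interpret prod: product_prob_space "\<lambda>_. M" I ..
  define T where "T i j w = (if Q (w i) \<and> Q (w j) then h (w i) (w j) - c else 0) /
    (1 + (\<Sum>m\<in>I - {i, j}. of_bool (Q (w m))))" for i j w
  have W: "W = (\<lambda>w. c * (\<Sum>i\<in>I. of_bool (Q (w i))) + (\<Sum>i\<in>I. \<Sum>j\<in>I - {i}. T i j w))"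
    unfolding W_def T_def by (intro ext gini_sum_filter_eq \<open>finite I\<close>)
  have N: "integrable (Pi\<^sub>M I (\<lambda>_. M)) (\<lambda>w. of_bool (Q (w i)) :: real)"
      "(\<integral>w. of_bool (Q (w i)) \<partial>Pi\<^sub>M I (\<lambda>_. M)) = prob {a \<in> space M. Q a}" if i: "i \<in> I" for i
  proof -
    have comp [measurable]: "(\<lambda>w. w i) \<in> Pi\<^sub>M I (\<lambda>_. M) \<rightarrow>\<^sub>M M"
      using i by simp
    show "integrable (Pi\<^sub>M I (\<lambda>_. M)) (\<lambda>w. of_bool (Q (w i)) :: real)"
      by (rule prod.P.integrable_const_bound[where B = 1]) auto
    have "(\<integral>w. (of_bool (Q (w i)) :: real) \<partial>Pi\<^sub>M I (\<lambda>_. M))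
        = (\<integral>a. of_bool (Q a) \<partial>distr (Pi\<^sub>M I (\<lambda>_. M)) M (\<lambda>w. w i))"
      by (subst integral_distr) auto
    also have "\<dots> = (\<integral>a. indicator {a \<in> space M. Q a} a \<partial>M)"
      unfolding prod.PiM_component[OF i] by (intro Bochner_Integration.integral_cong) auto
    finally show "(\<integral>w. of_bool (Q (w i)) \<partial>Pi\<^sub>M I (\<lambda>_. M)) = prob {a \<in> space M. Q a}"
      by simp
  qed
  have T: "integrable (Pi\<^sub>M I (\<lambda>_. M)) (T i j)" "integral\<^sup>L (Pi\<^sub>M I (\<lambda>_. M)) (T i j) = 0"
    if ij: "i \<in> I" "j \<in> I - {i}" for i j
  proof -
    define I1 I2 where "I1 = I - {i}" and "I2 = I - {i, j}"
    have I: "I = insert i I1" "I1 = insert j I2" "i \<notin> I1" "j \<notin> I2" "finite I1" "finite I2" "i \<notin> I2" "i \<noteq> j"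
      using ij \<open>finite I\<close> by (auto simp: I1_def I2_def)
    interpret P1: prob_space "Pi\<^sub>M I1 (\<lambda>_. M)" by (rule prob_space_PiM) (rule prob_space_axioms)
    have [measurable]: "(\<lambda>w. \<Sum>m\<in>I - {i, j}. of_bool (Q (w m)) :: real) \<in> borel_measurable (Pi\<^sub>M I (\<lambda>_. M))"
    proof (rule borel_measurable_sum)
      fix m assume "m \<in> I - {i, j}"
      then have [measurable]: "(\<lambda>w. w m) \<in> Pi\<^sub>M I (\<lambda>_. M) \<rightarrow>\<^sub>M M"
        by simp
      show "(\<lambda>w. of_bool (Q (w m)) :: real) \<in> borel_measurable (Pi\<^sub>M I (\<lambda>_. M))"
        by measurable
    qed
    have [measurable]: "(\<lambda>w. w i) \<in> Pi\<^sub>M I (\<lambda>_. M) \<rightarrow>\<^sub>M M" "(\<lambda>w. w j) \<in> Pi\<^sub>M I (\<lambda>_. M) \<rightarrow>\<^sub>M M"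
      using ij by auto
    have T_meas [measurable]: "T i j \<in> borel_measurable (Pi\<^sub>M I (\<lambda>_. M))"
      unfolding T_def by measurable
    have T_bound: "\<bar>T i j w\<bar> \<le> 1" for w
    proof -
      have "0 \<le> (\<Sum>m\<in>I - {i, j}. of_bool (Q (w m)) :: real)"
        by (intro sum_nonneg) auto
      then show ?thesis
        using h[of "w i" "w j"] c by (auto simp: T_def divide_le_eq abs_le_iff le_divide_eq)
    qed
    show int: "integrable (Pi\<^sub>M I (\<lambda>_. M)) (T i j)"
      by (rule prod.P.integrable_const_bound[where B = 1]) (use T_bound in auto)
    have upd [measurable]: "(\<lambda>(w, a). w(i := a)) \<in> Pi\<^sub>M I1 (\<lambda>_. M) \<Otimes>\<^sub>M M \<rightarrow>\<^sub>M Pi\<^sub>M I (\<lambda>_. M)"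
      unfolding I(1) by measurable
    \<comment> \<open>Coordinate \<open>i\<close> is integrated out first and \<open>j\<close> next,
      with all others held fixed.\<close>
    define F where "F w = (\<integral>a. T i j (w(i := a)) \<partial>M)" for w
    have F_meas [measurable]: "F \<in> borel_measurable (Pi\<^sub>M I1 (\<lambda>_. M))"
      unfolding F_def by measurable
    have F_bound: "\<bar>F w\<bar> \<le> 1" if w: "w \<in> space (Pi\<^sub>M I1 (\<lambda>_. M))" for w
    proof -
      have "(\<lambda>a. T i j (w(i := a))) \<in> borel_measurable M"
        using w by measurable
      then have int: "integrable M (\<lambda>a. T i j (w(i := a)))"
        by (rule integrable_const_bound[where B = 1, rotated]) (use T_bound in auto)
      have "\<bar>F w\<bar> \<le> (\<integral>a. \<bar>T i j (w(i := a))\<bar> \<partial>M)"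
        unfolding F_def by (rule integral_abs_bound)
      also have "\<dots> \<le> (\<integral>a. 1 \<partial>M)"
        by (rule integral_mono) (use int T_bound in auto)
      finally show ?thesis by (simp add: prob_space)
    qed
    have "integrable (Pi\<^sub>M I1 (\<lambda>_. M)) F"
      by (rule P1.integrable_const_bound[where B = 1]) (use F_bound in auto)
    have "integral\<^sup>L (Pi\<^sub>M I (\<lambda>_. M)) (T i j) = integral\<^sup>L (Pi\<^sub>M I1 (\<lambda>_. M)) F"
      unfolding F_def using int I by (subst I(1)) (simp add: prod.product_integral_insert)
    also have "\<dots> = (\<integral>w. \<integral>b. F (w(j := b)) \<partial>M \<partial>Pi\<^sub>M I2 (\<lambda>_. M))"
      using \<open>integrable (Pi\<^sub>M I1 (\<lambda>_. M)) F\<close> I by (simp add: prod.product_integral_insert)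
    also have "\<dots> = (\<integral>w. 0 \<partial>Pi\<^sub>M I2 (\<lambda>_. M))"
    proof (rule Bochner_Integration.integral_cong[OF refl])
      fix w
      \<comment> \<open>The denominator is constant in both integrations, so the double integral is
        the one in \<open>zero\<close> divided by \<open>N\<close>.\<close>
      define N where "N = 1 + (\<Sum>m\<in>I2. of_bool (Q (w m)) :: real)"
      have "T i j (w(j := b, i := a)) = (if Q a \<and> Q b then h a b - c else 0) / N" for a b
      proof -
        have "(\<Sum>m\<in>I2. of_bool (Q ((w(j := b, i := a)) m)) :: real) = (\<Sum>m\<in>I2. of_bool (Q (w m)))"
          using I by (intro sum.cong) auto
        then show ?thesis
          using I(8) by (simp add: T_def N_def flip: I2_def)
      qed
      then have "(\<integral>b. F (w(j := b)) \<partial>M)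
          = (\<integral>b. (\<integral>a. (if Q a \<and> Q b then h a b - c else 0) \<partial>M) / N \<partial>M)"
        unfolding F_def by simp
      then show "(\<integral>b. F (w(j := b)) \<partial>M) = 0"
        by (simp add: zero)
    qed
    finally show "integral\<^sup>L (Pi\<^sub>M I (\<lambda>_. M)) (T i j) = 0" by simp
  qed
  have sums: "integrable (Pi\<^sub>M I (\<lambda>_. M)) (\<lambda>w. \<Sum>i\<in>I. of_bool (Q (w i)) :: real)"
      "integrable (Pi\<^sub>M I (\<lambda>_. M)) (\<lambda>w. \<Sum>i\<in>I. \<Sum>j\<in>I - {i}. T i j w)"
    using N T by (auto intro!: Bochner_Integration.integrable_sum)
  show "integrable (Pi\<^sub>M I (\<lambda>_. M)) W"
    unfolding W using sums by simp
  have "(\<integral>w. (\<Sum>i\<in>I. \<Sum>j\<in>I - {i}. T i j w) \<partial>Pi\<^sub>M I (\<lambda>_. M))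
      = (\<Sum>i\<in>I. \<integral>w. (\<Sum>j\<in>I - {i}. T i j w) \<partial>Pi\<^sub>M I (\<lambda>_. M))"
    using T(1) by (intro Bochner_Integration.integral_sum Bochner_Integration.integrable_sum)
  also have "\<dots> = (\<Sum>i\<in>I. \<Sum>j\<in>I - {i}. 0)"
    using T by (intro sum.cong refl) (simp add: Bochner_Integration.integral_sum)
  finally show "integral\<^sup>L (Pi\<^sub>M I (\<lambda>_. M)) W = c * real (card I) * prob {a \<in> space M. Q a}"
    unfolding W using sums N by simp
qed

section \<open>The sample covariance\<close>

text \<open>Symmetry makes the sum over ordered pairs twice the sum over i < j, and this 2 cancels
  against the one in the binomial coefficient.\<close>

lemma gini_mean_eq_gini_sum:
  assumes "finite J" "card J \<ge> 2" "\<And>a b. d a b = d b a"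
  shows "real (card J) * gini_mean d J x = gini_sum c (\<lambda>i j. d (x i) (x j)) J"
proof -
  define U where "U = {(i, j) \<in> J \<times> J. i < j}"
  let ?e = "\<lambda>(i, j). d (x i) (x j)"
  have U: "finite U" "finite (prod.swap ` U)" "U \<inter> prod.swap ` U = {}"
    using finite_subset[of U "J \<times> J"] assms(1) by (auto simp: U_def)
  have "(\<Sum>i\<in>J. \<Sum>j\<in>J - {i}. d (x i) (x j)) = sum ?e (SIGMA i:J. J - {i})"
    using assms(1) by (simp add: sum.Sigma)
  also have "(SIGMA i:J. J - {i}) = U \<union> prod.swap ` U"
    by (auto simp: U_def image_iff)
  also have "sum ?e \<dots> = sum ?e U + sum ?e (prod.swap ` U)"
    using U by (intro sum.union_disjoint)
  also have "sum ?e (prod.swap ` U) = sum ?e U"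
    using assms(3) by (subst sum.reindex) (auto intro!: sum.cong simp: case_prod_unfold)
  finally have S: "(\<Sum>i\<in>J. \<Sum>j\<in>J - {i}. d (x i) (x j)) = 2 * sum ?e U"
    by simp
  have C: "real (card J choose 2) = real (card J) * (real (card J) - 1) / 2"
    using assms(2) by (simp add: choose_two real_of_nat_div of_nat_diff)
  have G: "gini_sum c (\<lambda>i j. d (x i) (x j)) J = 2 * sum ?e U / (real (card J) - 1)"
    using assms(1,2) S by (subst gini_sum_eq) auto
  show ?thesis
    using assms(2) unfolding G gini_mean_def C U_def[symmetric] by (simp add: field_simps)
qed

lemma kernel_dist_commute:
  "mercer_kernel \<kappa> \<Longrightarrow> kernel_dist \<kappa> a b = kernel_dist \<kappa> b a"
  by (simp add: mercer_kernel_def kernel_dist_def add.commute)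

text \<open>Continuity gives measurability for the Borel sets of the product topology; by second
  countability these form the product sigma-algebra.\<close>

lemma borel_measurable_kernel_dist:
  fixes \<kappa> :: "'a::second_countable_topology \<Rightarrow> 'a \<Rightarrow> real"
  assumes "mercer_kernel \<kappa>"
  shows "case_prod (kernel_dist \<kappa>) \<in> borel_measurable (borel \<Otimes>\<^sub>M borel)"
proof -
  have [measurable]: "(\<lambda>z. \<kappa> (fst z) (snd z)) \<in> borel_measurable (borel \<Otimes>\<^sub>M borel)"
    using assms borel_measurable_continuous_onI
    by (auto simp: mercer_kernel_def case_prod_unfold borel_prod)
  have [measurable]: "(\<lambda>z. \<kappa> (f z) (g z)) \<in> borel_measurable (borel \<Otimes>\<^sub>M borel)"
    if "f \<in> borel \<Otimes>\<^sub>M borel \<rightarrow>\<^sub>M borel" "g \<in> borel \<Otimes>\<^sub>M borel \<rightarrow>\<^sub>M borel"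
    for f g :: "'a \<times> 'a \<Rightarrow> 'a"
    using measurable_compose[OF measurable_Pair[OF that], of "\<lambda>z. \<kappa> (fst z) (snd z)"] by simp
  show ?thesis
    unfolding kernel_dist_def case_prod_unfold by measurable
qed

section \<open>A random variable with finitely many labels and its conditional laws\<close>

locale labelled_variable = prob_space M
  for M :: "'w measure" +
  fixes X :: "'w \<Rightarrow> 'a::second_countable_topology" and Y :: "'w \<Rightarrow> 'l" and \<Lambda> :: "'l set"
    and d :: "'a \<Rightarrow> 'a \<Rightarrow> real"
  assumes X [measurable]: "X \<in> M \<rightarrow>\<^sub>M borel"
    and Y [measurable]: "Y \<in> M \<rightarrow>\<^sub>M count_space \<Lambda>"
    and finite_labels: "finite \<Lambda>"
    and prob_label_pos: "\<And>l. l \<in> \<Lambda> \<Longrightarrow> prob {\<omega> \<in> space M. Y \<omega> = l} > 0"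
    and d_measurable [measurable]: "case_prod d \<in> borel_measurable (borel \<Otimes>\<^sub>M borel)"
    and d_commute: "\<And>a b. d a b = d b a"
    and d_range: "\<And>a b. d a b \<in> {0..1}"
begin

abbreviation p :: "'l \<Rightarrow> real" where
  "p l \<equiv> prob {\<omega> \<in> space M. Y \<omega> = l}"

abbreviation F :: "'a measure" where
  "F \<equiv> distr M borel X"

abbreviation F_cond :: "'l \<Rightarrow> 'a measure" where
  "F_cond l \<equiv> cond_distr M X Y l"

abbreviation S :: "('a \<times> 'l) measure" where
  "S \<equiv> borel \<Otimes>\<^sub>M count_space \<Lambda>"

abbreviation D :: "('a \<times> 'l) measure" where
  "D \<equiv> distr M S (\<lambda>\<omega>. (X \<omega>, Y \<omega>))"

definition stat :: "'i set \<Rightarrow> ('i \<Rightarrow> 'a \<times> 'l) \<Rightarrow> real" where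
  "stat I w = (gini_sum (expected_dist d F F) (\<lambda>i j. d (fst (w i)) (fst (w j))) I -
     (\<Sum>l\<in>\<Lambda>. gini_sum (expected_dist d (F_cond l) (F_cond l))
        (\<lambda>i j. d (fst (w i)) (fst (w j))) {i \<in> I. snd (w i) = l})) / real (card I)"

lemma label_measurable [measurable]: "{\<omega> \<in> space M. Y \<omega> = l} \<in> sets M"
proof -
  have "Measurable.pred (count_space \<Lambda>) (\<lambda>y. y = l)" by simp
  then show ?thesis using measurable_compose[OF Y] by (simp add: pred_def)
qed

lemma snd_measurable [measurable]: "Measurable.pred S (\<lambda>z. snd z = l)"
proof -
  have "Measurable.pred (count_space \<Lambda>) (\<lambda>y. y = l)" by simp
  from measurable_compose[OF measurable_snd this] show ?thesis .
qed

lemma F_prob_space: "prob_space F"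
  by (rule prob_space_distr) measurable

lemma F_cond_prob_space: "l \<in> \<Lambda> \<Longrightarrow> prob_space (F_cond l)"
  unfolding cond_distr_def using prob_label_pos[of l]
  by (intro prob_space.prob_space_distr prob_space_uniform_measure)
     (auto simp: emeasure_eq_measure)

lemma D_prob_space: "prob_space D"
  by (rule prob_space_distr) measurable

lemma sets_F_cond [simp, measurable_cong]: "sets (F_cond l) = sets borel"
  by (simp add: cond_distr_def)

text \<open>Multiplying by \<open>p l\<close> clears the normalisation of the conditional law, so
  that sums over labels become sums of plain integrals over \<open>M\<close>.\<close>

lemma integral_F_cond:
  assumes [measurable]: "g \<in> borel_measurable borel" and l: "l \<in> \<Lambda>"
  shows "p l * integral\<^sup>L (F_cond l) g = (\<integral>\<omega>. (if Y \<omega> = l then g (X \<omega>) else 0) \<partial>M)"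
proof -
  let ?A = "{\<omega> \<in> space M. Y \<omega> = l}"
  have p: "p l > 0" using prob_label_pos[OF l] .
  have "integral\<^sup>L (F_cond l) g = (\<integral>\<omega>. g (X \<omega>) \<partial>uniform_measure M ?A)"
    unfolding cond_distr_def by (rule integral_distr) measurable
  \<comment> \<open>A real-valued density turns the integral into a Bochner integral with a scalar
    weight.\<close>
  also have "uniform_measure M ?A = density M (\<lambda>\<omega>. ennreal (indicator ?A \<omega> / p l))"
    unfolding uniform_measure_def using p divide_ennreal[of 1 "p l"]
    by (intro density_cong) (auto simp: emeasure_eq_measure split: split_indicator)
  also have "(\<integral>\<omega>. g (X \<omega>) \<partial>\<dots>) = (\<integral>\<omega>. (indicator ?A \<omega> / p l) *\<^sub>R g (X \<omega>) \<partial>M)"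
    by (rule integral_density) auto
  also have "\<dots> = (\<integral>\<omega>. (if Y \<omega> = l then g (X \<omega>) else 0) / p l \<partial>M)"
    by (intro Bochner_Integration.integral_cong) auto
  finally show ?thesis
    using p by simp
qed

lemma integral_D_label:
  assumes [measurable]: "g \<in> borel_measurable borel" and l: "l \<in> \<Lambda>"
  shows "(\<integral>z. (if snd z = l then g (fst z) else 0) \<partial>D) = p l * integral\<^sup>L (F_cond l) g"
  by (subst integral_distr) (auto simp: integral_F_cond[OF assms] cong: if_cong)

lemma integral_D:
  fixes g :: "'a \<Rightarrow> real"
  assumes [measurable]: "g \<in> borel_measurable borel"
  shows "(\<integral>z. g (fst z) \<partial>D) = integral\<^sup>L F g"
  by (subst (1 2) integral_distr) auto

text \<open>This is the mixture identity F = sum of p_k F_k: since \<open>Y\<close> takes its values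
  in \<open>\<Lambda>\<close>, exactly one summand is active at each point.\<close>

lemma sum_integral_F_cond:
  assumes [measurable]: "g \<in> borel_measurable borel" and g: "\<And>x. \<bar>g x\<bar> \<le> B"
  shows "(\<Sum>l\<in>\<Lambda>. p l * integral\<^sup>L (F_cond l) g) = integral\<^sup>L F g"
proof -
  \<comment> \<open>Off the label the integrand is 0, and \<open>B\<close> has to dominate that
    value as well.\<close>
  have B: "B \<ge> 0" using g[of undefined] by linarith
  have "(\<Sum>l\<in>\<Lambda>. p l * integral\<^sup>L (F_cond l) g)
      = (\<Sum>l\<in>\<Lambda>. \<integral>\<omega>. (if Y \<omega> = l then g (X \<omega>) else 0) \<partial>M)"
    by (simp add: integral_F_cond)
  also have "\<dots> = (\<integral>\<omega>. (\<Sum>l\<in>\<Lambda>. if Y \<omega> = l then g (X \<omega>) else 0) \<partial>M)"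
    by (intro Bochner_Integration.integral_sum[symmetric] integrable_const_bound[where B = B])
       (use g B in auto)
  also have "\<dots> = (\<integral>\<omega>. g (X \<omega>) \<partial>M)"
    using measurable_space[OF Y] finite_labels
    by (intro Bochner_Integration.integral_cong) auto
  also have "\<dots> = integral\<^sup>L F g"
    by (simp add: integral_distr)
  finally show ?thesis .
qed

section \<open>Expected distances between the laws\<close>

lemma expected_dist_iterated:
  assumes "prob_space P" "prob_space Q" and [measurable_cong]: "sets P = sets borel" "sets Q = sets borel"
  shows "expected_dist d P Q = (\<integral>x. \<integral>y. d x y \<partial>Q \<partial>P)"
    and "expected_dist d P Q \<in> {0..1}"
proof -
  interpret P: prob_space P by fact
  interpret Q: prob_space Q by fact
  interpret PQ: pair_prob_space P Q ..
  have int: "integrable (P \<Otimes>\<^sub>M Q) (\<lambda>z. d (fst z) (snd z))"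
    by (rule PQ.P.integrable_const_bound[where B = 1]) (use d_range in auto)
  then show "expected_dist d P Q = (\<integral>x. \<integral>y. d x y \<partial>Q \<partial>P)"
    unfolding expected_dist_def by (subst PQ.integral_fst'[symmetric]) auto
  show "expected_dist d P Q \<in> {0..1}"
    unfolding expected_dist_def using int d_range
    by (auto intro!: PQ.P.integral_le_const integral_nonneg_AE)
qed

lemma partial_mean:
  assumes "prob_space Q" and [measurable_cong]: "sets Q = sets borel"
  shows "(\<lambda>x. \<integral>y. d x y \<partial>Q) \<in> borel_measurable borel" "\<bar>\<integral>y. d x y \<partial>Q\<bar> \<le> 1"
    "integrable Q (d x)"
proof -
  interpret Q: prob_space Q by fact
  show "(\<lambda>x. \<integral>y. d x y \<partial>Q) \<in> borel_measurable borel"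
    by measurable
  show int: "integrable Q (d x)"
    by (rule Q.integrable_const_bound[where B = 1]) (use d_range in auto)
  have "(\<integral>y. d x y \<partial>Q) \<in> {0..1}"
    using int d_range by (auto intro!: Q.integral_le_const integral_nonneg_AE)
  then show "\<bar>\<integral>y. d x y \<partial>Q\<bar> \<le> 1" by auto
qed

lemma sum_p: "(\<Sum>l\<in>\<Lambda>. p l) = 1"
  using sum_integral_F_cond[of "\<lambda>_. 1" 1] prob_space.prob_space[OF F_cond_prob_space]
    prob_space.prob_space[OF F_prob_space] by simp

text \<open>This links the two forms of the population covariance. Mixing over the first argument
  turns the cross terms into \<open>expected_dist d F F\<close>; twice that value minus itself
  leaves one copy.\<close>

lemma sum_p_expected_dist:
  "(\<Sum>l\<in>\<Lambda>. p l * (2 * expected_dist d (F_cond l) F - expected_dist d (F_cond l) (F_cond l) -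
      expected_dist d F F))
   = expected_dist d F F - (\<Sum>l\<in>\<Lambda>. p l * expected_dist d (F_cond l) (F_cond l))"
proof -
  have "(\<Sum>l\<in>\<Lambda>. p l * expected_dist d (F_cond l) F)
      = (\<Sum>l\<in>\<Lambda>. p l * (\<integral>x. (\<integral>y. d x y \<partial>F) \<partial>F_cond l))"
    by (intro sum.cong) (auto simp: expected_dist_iterated F_prob_space F_cond_prob_space)
  also have "\<dots> = (\<integral>x. (\<integral>y. d x y \<partial>F) \<partial>F)"
    by (rule sum_integral_F_cond[where B = 1]) (use partial_mean F_prob_space in auto)
  also have "\<dots> = expected_dist d F F"
    by (simp add: expected_dist_iterated F_prob_space)
  finally show ?thesis
    using sum_p by (simp add: algebra_simps sum_subtractf sum.distrib flip: sum_distrib_left sum_distrib_right)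
qed

text \<open>This supplies the assumption \<open>zero\<close> of \<open>expectation_gini_sum\<close>
  for a class: each integration over \<open>D\<close> restricted to the label is \<open>p l\<close>
  times one over \<open>F_cond l\<close>, where the centred distance has mean 0.\<close>

lemma D_degenerate_label:
  assumes l: "l \<in> \<Lambda>"
  defines "c \<equiv> expected_dist d (F_cond l) (F_cond l)"
  shows "(\<integral>b. \<integral>a. (if snd a = l \<and> snd b = l then d (fst a) (fst b) - c else 0) \<partial>D \<partial>D) = 0"
proof -
  let ?G = "F_cond l"
  interpret G: prob_space ?G by (rule F_cond_prob_space[OF l])
  note part = partial_mean[OF F_cond_prob_space[OF l] sets_F_cond]
  have "(\<integral>a. (if snd a = l \<and> snd b = l then d (fst a) (fst b) - c else 0) \<partial>D)
      = (if snd b = l then p l * ((\<integral>x. d (fst b) x \<partial>?G) - c) else 0)" for b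
  proof (cases "snd b = l")
    case True
    have "(\<integral>a. (if snd a = l then d (fst a) (fst b) - c else 0) \<partial>D)
        = p l * (\<integral>x. d x (fst b) - c \<partial>?G)"
      by (rule integral_D_label[OF _ l]) measurable
    \<comment> \<open>Symmetry of \<open>d\<close> brings the partial mean into the form covered by
      \<open>partial_mean\<close>.\<close>
    also have "(\<integral>x. d x (fst b) - c \<partial>?G) = (\<integral>x. d (fst b) x - c \<partial>?G)"
      by (simp add: d_commute[of _ "fst b"])
    finally show ?thesis
      using True part(3) by (simp add: G.prob_space)
  qed simp
  then have "(\<integral>b. \<integral>a. (if snd a = l \<and> snd b = l then d (fst a) (fst b) - c else 0) \<partial>D \<partial>D)
      = (\<integral>b. (if snd b = l then p l * ((\<integral>x. d (fst b) x \<partial>?G) - c) else 0) \<partial>D)"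
    by simp
  also have "\<dots> = p l * (\<integral>y. p l * ((\<integral>x. d y x \<partial>?G) - c) \<partial>?G)"
    by (rule integral_D_label[OF _ l]) (use part in measurable)
  also have "integrable ?G (\<lambda>y. \<integral>x. d y x \<partial>?G)"
    by (rule G.integrable_const_bound[where B = 1]) (use part in auto)
  then have "(\<integral>y. p l * ((\<integral>x. d y x \<partial>?G) - c) \<partial>?G) = 0"
    by (simp add: c_def expected_dist_iterated F_cond_prob_space l G.prob_space)
  finally show ?thesis by simp
qed

text \<open>The counterpart for the pooled sample, where the class predicate is constantly
  true.\<close>

lemma D_degenerate:
  defines "c \<equiv> expected_dist d F F"
  shows "(\<integral>b. \<integral>a. d (fst a) (fst b) - c \<partial>D \<partial>D) = 0"
proof -
  interpret F: prob_space F by (rule F_prob_space)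
  note part = partial_mean[OF F_prob_space sets_distr]
  have "(\<integral>a. d (fst a) (fst b) - c \<partial>D) = (\<integral>x. d (fst b) x \<partial>F) - c" for b :: "'a \<times> 'l"
  proof -
    have "(\<integral>a. d (fst a) (fst b) - c \<partial>D) = (\<integral>x. d x (fst b) - c \<partial>F)"
      by (rule integral_D) measurable
    also have "(\<integral>x. d x (fst b) - c \<partial>F) = (\<integral>x. d (fst b) x - c \<partial>F)"
      by (simp add: d_commute[of _ "fst b"])
    finally show ?thesis
      using part(3) F.prob_space by simp
  qed
  then have "(\<integral>b. \<integral>a. d (fst a) (fst b) - c \<partial>D \<partial>D) = (\<integral>b. (\<integral>x. d (fst b) x \<partial>F) - c \<partial>D)"
    by simp
  also have "\<dots> = (\<integral>y. (\<integral>x. d y x \<partial>F) - c \<partial>F)"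
    by (rule integral_D) (use part in measurable)
  also have "integrable F (\<lambda>y. \<integral>x. d y x \<partial>F)"
    by (rule F.integrable_const_bound[where B = 1]) (use part in auto)
  then have "(\<integral>y. (\<integral>x. d y x \<partial>F) - c \<partial>F) = 0"
    using F.prob_space by (simp add: c_def expected_dist_iterated F_prob_space)
  finally show ?thesis by simp
qed

section \<open>Mean and concentration of the modified statistic\<close>

lemma expectation_stat:
  fixes I :: "'i set"
  assumes "finite I" "I \<noteq> {}"
  shows "integrable (Pi\<^sub>M I (\<lambda>_. D)) (stat I)"
    and "integral\<^sup>L (Pi\<^sub>M I (\<lambda>_. D)) (stat I)
       = expected_dist d F F - (\<Sum>l\<in>\<Lambda>. p l * expected_dist d (F_cond l) (F_cond l))"
proof -
  interpret D: prob_space D by (rule D_prob_space)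
  let ?h = "\<lambda>(a :: 'a \<times> 'l) (b :: 'a \<times> 'l). d (fst a) (fst b)"
  let ?P = "Pi\<^sub>M I (\<lambda>_. D)"
  let ?A = "\<lambda>w. gini_sum (expected_dist d F F) (\<lambda>i j. ?h (w i) (w j)) I"
  let ?B = "\<lambda>l w. gini_sum (expected_dist d (F_cond l) (F_cond l)) (\<lambda>i j. ?h (w i) (w j))
    {i \<in> I. snd (w i) = l}"
  have h: "case_prod ?h \<in> borel_measurable (D \<Otimes>\<^sub>M D)" "\<And>a b. ?h a b \<in> {0..1}"
    by measurable (use d_range in auto)
  have A: "integrable ?P ?A" "integral\<^sup>L ?P ?A = real (card I) * expected_dist d F F"
    using D.expectation_gini_sum[of I "\<lambda>_. True" ?h "expected_dist d F F"] assms h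
      expected_dist_iterated(2) F_prob_space D_degenerate D.prob_space by simp_all
  \<comment> \<open>\<open>expectation_gini_sum\<close> returns the class probability under the
    joint law \<open>D\<close>, while \<open>p\<close> is measured on \<open>M\<close>.\<close>
  have "prob {\<omega> \<in> space M. Y \<omega> = l} = D.prob {z \<in> space D. snd z = l}" for l
    using snd_measurable[of l]
    by (subst measure_distr) (auto intro!: arg_cong[where f = prob] dest: measurable_space[OF Y]
        simp: space_pair_measure pred_def)
  then have B: "integrable ?P (?B l)"
      "integral\<^sup>L ?P (?B l) = real (card I) * (p l * expected_dist d (F_cond l) (F_cond l))"
    if "l \<in> \<Lambda>" for l
    using D.expectation_gini_sum[of I "\<lambda>z. snd z = l" ?h "expected_dist d (F_cond l) (F_cond l)"]
      assms h expected_dist_iterated(2) F_cond_prob_space[OF that] D_degenerate_label[OF that]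
    by simp_all
  have stat: "stat I = (\<lambda>w. (?A w - (\<Sum>l\<in>\<Lambda>. ?B l w)) / real (card I))"
    by (auto simp: stat_def)
  show "integrable ?P (stat I)"
    unfolding stat using A B by simp
  have "integral\<^sup>L ?P (stat I) = (integral\<^sup>L ?P ?A - (\<Sum>l\<in>\<Lambda>. integral\<^sup>L ?P (?B l))) / real (card I)"
    unfolding stat using A B by simp
  also have "\<dots> = expected_dist d F F - (\<Sum>l\<in>\<Lambda>. p l * expected_dist d (F_cond l) (F_cond l))"
    using A B assms by (simp add: card_gt_0_iff diff_divide_distrib flip: sum_distrib_left)
  finally show "integral\<^sup>L ?P (stat I)
       = expected_dist d F F - (\<Sum>l\<in>\<Lambda>. p l * expected_dist d (F_cond l) (F_cond l))" .
qed

lemma stat_bounded_differences: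
  fixes I :: "'i set"
  assumes "finite I" "w \<in> space (Pi\<^sub>M I (\<lambda>_. D))" "i \<in> I" "z \<in> space D"
  shows "\<bar>stat I w - stat I (w(i := z))\<bar> \<le> 5 / real (card I)"
proof -
  have labels: "snd (w i) \<in> \<Lambda>" "snd z \<in> \<Lambda>"
    using assms by (auto simp: space_PiM space_pair_measure PiE_iff)
  let ?e = "\<lambda>w i j. d (fst (w i)) (fst (w j))"
  let ?A = "\<lambda>w. gini_sum (expected_dist d F F) (?e w) I"
  let ?B = "\<lambda>w. \<Sum>l\<in>\<Lambda>. gini_sum (expected_dist d (F_cond l) (F_cond l)) (?e w)
    {i \<in> I. snd (w i) = l}"
  have "\<bar>?A w - ?A (w(i := z))\<bar> \<le> 2"
    using gini_sum_move_diff[of "I - {i}" i "?e w" "?e (w(i := z))" "expected_dist d F F"]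
      assms d_commute d_range by (simp add: insert_absorb)
  moreover have "\<bar>?B w - ?B (w(i := z))\<bar> \<le> 3"
    by (rule sum_gini_sum_upd)
       (use assms labels d_commute d_range finite_labels expected_dist_iterated(2) F_cond_prob_space in auto)
  ultimately have "\<bar>(?A w - ?B w) - (?A (w(i := z)) - ?B (w(i := z)))\<bar> \<le> 5"
    by linarith
  moreover have "stat I w - stat I (w(i := z)) =
      ((?A w - ?B w) - (?A (w(i := z)) - ?B (w(i := z)))) / real (card I)"
    by (simp only: stat_def diff_divide_distrib)
  ultimately show ?thesis
    by (simp add: abs_divide divide_right_mono del: fun_upd_apply)
qed


lemma stat_tail_bounds:
  fixes I :: "'i set"
  assumes I: "finite I" "I \<noteq> {}" and "\<epsilon> > 0"
  defines "P \<equiv> Pi\<^sub>M I (\<lambda>_. D)"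
    and "\<mu> \<equiv> expected_dist d F F - (\<Sum>l\<in>\<Lambda>. p l * expected_dist d (F_cond l) (F_cond l))"
  shows "measure P {w \<in> space P. stat I w - \<mu> \<ge> \<epsilon>} \<le> exp (- (real (card I) * \<epsilon>\<^sup>2) / 12.5)"
    and "measure P {w \<in> space P. \<mu> - stat I w \<ge> \<epsilon>} \<le> exp (- (real (card I) * \<epsilon>\<^sup>2) / 12.5)"
proof -
  interpret D: prob_space D by (rule D_prob_space)
  interpret prod: product_prob_space "\<lambda>_. D" I ..
  let ?c = "\<lambda>_ :: 'i. 5 / real (card I)"
  note stat = expectation_stat[OF I, folded P_def \<mu>_def]
  \<comment> \<open>The sum of squares is n (5/n)^2 = 25/n.\<close>
  have pos: "(\<Sum>i\<in>I. (?c i)\<^sup>2) > 0" and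
    rate: "- 2 * \<epsilon>\<^sup>2 / (\<Sum>i\<in>I. (?c i)\<^sup>2) = - (real (card I) * \<epsilon>\<^sup>2) / 12.5"
    using I by (auto simp: card_gt_0_iff power2_eq_square field_simps)
  \<comment> \<open>The second bound serves the lower tail, which is the upper tail of
    \<open>- stat I\<close>.\<close>
  have diff: "\<bar>stat I w - stat I (w(i := z))\<bar> \<le> ?c i"
      "\<bar>- stat I w - - stat I (w(i := z))\<bar> \<le> ?c i"
    if "w \<in> space (Pi\<^sub>M I (\<lambda>_. D))" "i \<in> I" "z \<in> space D" for w i z
    using stat_bounded_differences[OF I(1) that] by linarith+
  show "measure P {w \<in> space P. stat I w - \<mu> \<ge> \<epsilon>} \<le> exp (- (real (card I) * \<epsilon>\<^sup>2) / 12.5)"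
    using prod.McDiarmid_ineq_ge[OF I(1) _ \<open>\<epsilon> > 0\<close> pos diff(1)]
      borel_measurable_integrable[OF stat(1)] unfolding rate P_def[symmetric] stat(2) by simp
  have "(\<lambda>w. - stat I w) \<in> borel_measurable P"
    using borel_measurable_integrable[OF stat(1)] by simp
  moreover have "(\<integral>w. - stat I w \<partial>P) = - \<mu>"
    using stat by simp
  ultimately show "measure P {w \<in> space P. \<mu> - stat I w \<ge> \<epsilon>} \<le> exp (- (real (card I) * \<epsilon>\<^sup>2) / 12.5)"
    using prod.McDiarmid_ineq_ge[OF I(1) _ \<open>\<epsilon> > 0\<close> pos diff(2)]
    unfolding rate P_def[symmetric] by (simp add: algebra_simps)
qed

end

section \<open>Transfer from the product space to the sample\<close>

theorem theorem4:
  fixes M :: "'w measure"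
    and X :: "'w \<Rightarrow> real ^ 'q"
    and Y :: "'w \<Rightarrow> 'l"
    and L :: "nat \<Rightarrow> 'l"
    and K n :: nat
    and x :: "nat \<Rightarrow> 'w \<Rightarrow> real ^ 'q"
    and y :: "nat \<Rightarrow> 'w \<Rightarrow> 'l"
    and \<kappa> :: "real ^ 'q \<Rightarrow> real ^ 'q \<Rightarrow> real"
    and \<epsilon> :: real
  assumes "prob_space M"
    and "inj_on L {1..K}"
    and "X \<in> M \<rightarrow>\<^sub>M borel"
    and "Y \<in> M \<rightarrow>\<^sub>M count_space (L ` {1..K})"
    and "\<forall>k\<in>{1..K}. measure M {\<omega> \<in> space M. Y \<omega> = L k} \<in> {0<..<1}"
    and "prob_space.indep_vars M (\<lambda>_. borel \<Otimes>\<^sub>M count_space (L ` {1..K}))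
           (\<lambda>i \<omega>. (x i \<omega>, y i \<omega>)) {1..n}"
    and "\<forall>i\<in>{1..n}.
           distr M (borel \<Otimes>\<^sub>M count_space (L ` {1..K})) (\<lambda>\<omega>. (x i \<omega>, y i \<omega>)) =
           distr M (borel \<Otimes>\<^sub>M count_space (L ` {1..K})) (\<lambda>\<omega>. (X \<omega>, Y \<omega>))"
    and "mercer_kernel \<kappa>"
    and "\<forall>u v. kernel_dist \<kappa> u v \<in> {0..<1}"
    and "\<epsilon> > 0"
  shows "measure M {\<omega> \<in> space M.
             (\<forall>k\<in>{1..K}. card (class_indices n (\<lambda>i. y i \<omega>) (L k)) > 2) \<and>
             gCov_sample \<kappa> L K n (\<lambda>i. x i \<omega>) (\<lambda>i. y i \<omega>) - gCov \<kappa> M X Y L K \<ge> \<epsilon>}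
           \<le> exp (- (real n * \<epsilon>\<^sup>2) / 12.5) \<and>
         measure M {\<omega> \<in> space M.
             (\<forall>k\<in>{1..K}. card (class_indices n (\<lambda>i. y i \<omega>) (L k)) > 2) \<and>
             gCov \<kappa> M X Y L K - gCov_sample \<kappa> L K n (\<lambda>i. x i \<omega>) (\<lambda>i. y i \<omega>) \<ge> \<epsilon>}
           \<le> exp (- (real n * \<epsilon>\<^sup>2) / 12.5)"
proof -
  interpret prob_space M by fact
  define d where "d = kernel_dist \<kappa>"
  define \<Lambda> where "\<Lambda> = L ` {1..K}"
  \<comment> \<open>Continuity and symmetry of the kernel give measurability and symmetry of
    \<open>d\<close>; the range [0, 1) lies in [0, 1].\<close>
  interpret labelled_variable M X Y \<Lambda> d
    using assms borel_measurable_kernel_dist[of \<kappa>] kernel_dist_commute[of \<kappa>]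
    by unfold_locales (auto simp: \<Lambda>_def d_def less_imp_le)
  define \<mu> where "\<mu> = expected_dist d F F - (\<Sum>l\<in>\<Lambda>. p l * expected_dist d (F_cond l) (F_cond l))"
  define I where "I = {1..n}"
  \<comment> \<open>The restriction makes the sample a point of the product space, whose elements
    are undefined outside \<open>I\<close>.\<close>
  define Z where "Z \<omega> = (\<lambda>i\<in>I. (x i \<omega>, y i \<omega>))" for \<omega>
  let ?P = "Pi\<^sub>M I (\<lambda>_. D)"
  let ?G = "\<lambda>\<omega>. \<forall>k\<in>{1..K}. card (class_indices n (\<lambda>i. y i \<omega>) (L k)) > 2"
  let ?g = "\<lambda>\<omega>. gCov_sample \<kappa> L K n (\<lambda>i. x i \<omega>) (\<lambda>i. y i \<omega>)"
  \<comment> \<open>Injectivity of \<open>L\<close> turns the sum over indices into one over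
    labels.\<close>
  have gCov: "gCov \<kappa> M X Y L K = \<mu>"
    unfolding \<mu>_def sum_p_expected_dist[symmetric] unfolding \<Lambda>_def
    using assms(2) by (simp add: gCov_def Let_def d_def sum.reindex)
  show ?thesis
  \<comment> \<open>For an empty sample the bound equals 1, which any probability satisfies.\<close>
  proof (cases "n = 0")
    case False
    then have I: "finite I" "I \<noteq> {}" "card I = n"
      by (auto simp: I_def)
    have rv: "(\<lambda>\<omega>. (x i \<omega>, y i \<omega>)) \<in> M \<rightarrow>\<^sub>M S" if "i \<in> I" for i
      using assms(6) that by (auto simp: indep_vars_def I_def \<Lambda>_def)
    then have Z_S: "Z \<in> M \<rightarrow>\<^sub>M Pi\<^sub>M I (\<lambda>_. S)"
      unfolding Z_def by (intro measurable_restrict)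
    have sets_P: "sets (Pi\<^sub>M I (\<lambda>_. S)) = sets ?P"
      by (intro sets_PiM_cong) auto
    have Z [measurable]: "Z \<in> M \<rightarrow>\<^sub>M ?P"
      using Z_S measurable_cong_sets[OF refl sets_P] by blast
    \<comment> \<open>Independence makes the joint law a product, and identical distribution makes
      every factor \<open>D\<close>.\<close>
    have "distr M (Pi\<^sub>M I (\<lambda>_. S)) Z = Pi\<^sub>M I (\<lambda>i. distr M S (\<lambda>\<omega>. (x i \<omega>, y i \<omega>)))"
      using assms(6) I(2) rv unfolding Z_def I_def \<Lambda>_def
      by (subst (asm) indep_vars_iff_distr_eq_PiM') auto
    also have "\<dots> = ?P"
      using assms(7) by (intro PiM_cong) (auto simp: I_def \<Lambda>_def)
    finally have distr_Z: "distr M ?P Z = ?P"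
      using distr_cong[OF refl sets_P] by metis
    have sample: "?g \<omega> = stat I (Z \<omega>)" if "\<omega> \<in> space M" and G: "?G \<omega>" for \<omega>
    proof -
      let ?C = "\<lambda>l. class_indices n (\<lambda>i. y i \<omega>) l"
      let ?e = "\<lambda>i j. d (x i \<omega>) (x j \<omega>)"
      \<comment> \<open>\<open>Y\<close> only serves to show that some label exists. That class has
        more than two points, so the pooled sample does too and its Gini sum is not a default
        value.\<close>
      have "Y \<omega> \<in> \<Lambda>" using measurable_space[OF Y that(1)] by simp
      then obtain k where "k \<in> {1..K}" by (auto simp: \<Lambda>_def)
      with G have "2 < card (?C (L k))" by blast
      also have "\<dots> \<le> card I"
        by (intro card_mono) (auto simp: I_def class_indices_def)
      finally have all: "n * gini_mean d I (\<lambda>i. x i \<omega>)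
          = gini_sum (expected_dist d F F) ?e I"
        using I gini_mean_eq_gini_sum[where d = d and x = "\<lambda>i. x i \<omega>", OF I(1) _ d_commute] by simp
      have cls: "card (?C (L k)) * gini_mean d (?C (L k)) (\<lambda>i. x i \<omega>)
          = gini_sum (expected_dist d (F_cond (L k)) (F_cond (L k))) ?e (?C (L k))"
        if "k \<in> {1..K}" for k
        using G that by (intro gini_mean_eq_gini_sum d_commute) (auto simp: class_indices_def less_imp_le)
      have "?g \<omega> = (n * gini_mean d I (\<lambda>i. x i \<omega>) -
          (\<Sum>k=1..K. card (?C (L k)) * gini_mean d (?C (L k)) (\<lambda>i. x i \<omega>))) / n"
        using \<open>n \<noteq> 0\<close>
        by (simp add: gCov_sample_def d_def I_def diff_divide_distrib sum_divide_distrib)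
      also have "(\<Sum>k=1..K. card (?C (L k)) * gini_mean d (?C (L k)) (\<lambda>i. x i \<omega>))
          = (\<Sum>l\<in>\<Lambda>. gini_sum (expected_dist d (F_cond l) (F_cond l)) ?e (?C l))"
        using cls assms(2) by (simp add: \<Lambda>_def sum.reindex)
      also have "(n * gini_mean d I (\<lambda>i. x i \<omega>) - \<dots>) / n = stat I (Z \<omega>)"
        unfolding stat_def all I(3)
        by (intro arg_cong2[where f = "(/)"] arg_cong2[where f = "(-)"] sum.cong refl gini_sum_cong)
           (auto simp: Z_def I_def class_indices_def)
      finally show ?thesis .
    qed
    have stat_meas [measurable]: "stat I \<in> borel_measurable ?P"
      using expectation_stat(1)[OF I(1,2)] by simp
    \<comment> \<open>Where all classes are large the estimator equals
      \<open>stat I (Z \<omega>)\<close>, so the event is contained in the one for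
      \<open>stat\<close>, whose probability is computed under the law of \<open>Z\<close>.\<close>
    have transfer: "prob {\<omega> \<in> space M. ?G \<omega> \<and> R (?g \<omega>)} \<le> measure ?P {w \<in> space ?P. R (stat I w)}"
      if R [measurable]: "Measurable.pred borel R" for R
    proof -
      have "prob {\<omega> \<in> space M. ?G \<omega> \<and> R (?g \<omega>)} \<le> prob {\<omega> \<in> space M. R (stat I (Z \<omega>))}"
        using sample by (intro finite_measure_mono) auto
      also have "{\<omega> \<in> space M. R (stat I (Z \<omega>))} = Z -` {w \<in> space ?P. R (stat I w)} \<inter> space M"
        using measurable_space[OF Z] by auto
      also have "prob \<dots> = measure (distr M ?P Z) {w \<in> space ?P. R (stat I w)}"
        by (intro measure_distr[symmetric]) measurable
      finally show ?thesis
        unfolding distr_Z .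
    qed
    note tails = stat_tail_bounds[OF I(1,2) \<open>\<epsilon> > 0\<close>, folded \<mu>_def, unfolded I(3)]
    show ?thesis
      unfolding gCov
      using order_trans[OF transfer[of "\<lambda>r. r - \<mu> \<ge> \<epsilon>"] tails(1)]
        order_trans[OF transfer[of "\<lambda>r. \<mu> - r \<ge> \<epsilon>"] tails(2)] by simp
  qed simp
qed

end
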